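(* Let $N>k\ge 2$ be integers with $k>C\lceil\log_2(N)\rceil$ for some $C>\frac12$. Then $$\frac{\lceil\log_2(N-k+1)\rceil+k-2}{\lceil\log_2(\lceil N/k\rceil-1)\rceil+3k}<\frac{C+1}{3C}<1.$$
   Context: $C$ is a real number. *)

theory Defs
  imports Complex_Main
begin

end

theory Submission
  imports Defs
begin

text \<open>Bound the numerator from above and the denominator from below by multiples of
  \<open>k\<close>. Since \<open>N - k + 1\<close> is at most \<open>N\<close>, its rounded
  logarithm is at most that of \<open>N\<close>, hence below \<open>k / C\<close>, and the numerator
  is below \<open>k * (C + 1) / C\<close>. The logarithm in the denominator is nonnegative, so the
  denominator is at least \<open>3 * k\<close>. The quotient of these two bounds is
  \<open>(C + 1) / (3 * C)\<close>.\<close>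

theorem proposition16:
  fixes N k :: int and C :: real
  assumes "N > k" and "k \<ge> 2"
    and "C > 1 / 2"
    and "real_of_int k > C * real_of_int \<lceil>log 2 (real_of_int N)\<rceil>"
  shows "real_of_int (\<lceil>log 2 (real_of_int (N - k + 1))\<rceil> + k - 2)
           / real_of_int (\<lceil>log 2 (real_of_int (\<lceil>real_of_int N / real_of_int k\<rceil> - 1))\<rceil> + 3 * k)
         < (C + 1) / (3 * C)
       \<and> (C + 1) / (3 * C) < 1"
proof
  define L where "L = \<lceil>log 2 (real_of_int N)\<rceil>"
  define P where "P = \<lceil>log 2 (real_of_int (N - k + 1))\<rceil>"
  define Q where "Q = \<lceil>log 2 (real_of_int (\<lceil>real_of_int N / real_of_int k\<rceil> - 1))\<rceil>"
  have "P \<le> L"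
    unfolding P_def L_def using assms(1,2) by (intro ceiling_mono) simp
  \<comment> \<open>From \<open>N > k\<close> the ceiling of the quotient is at least 2, so after
    subtracting 1 the logarithm is still taken at a number \<ge> 1; this gives
    \<open>0 \<le> Q\<close>.\<close>
  have "1 < real_of_int N / real_of_int k"
    using assms(1,2) by simp
  then have "1 < \<lceil>real_of_int N / real_of_int k\<rceil>"
    by (simp add: less_ceiling_iff)
  then have "1 \<le> real_of_int (\<lceil>real_of_int N / real_of_int k\<rceil> - 1)"
    by linarith
  then have "0 \<le> log 2 (real_of_int (\<lceil>real_of_int N / real_of_int k\<rceil> - 1))"
    by simp
  then have "0 \<le> Q"
    unfolding Q_def by linarith
  have "real_of_int L < real_of_int k / C"
    using assms(3,4) by (simp add: L_def field_simps)
  \<comment> \<open>The strict inequality of the theorem enters here, through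
    \<open>L < k / C\<close>.\<close>
  with \<open>P \<le> L\<close> have "real_of_int (P + k - 2) < real_of_int k / C + real_of_int k"
    by linarith
  \<comment> \<open>Factoring out \<open>3 * k\<close> exposes the target ratio, so that
    \<open>3 * k\<close> can be enlarged to the true denominator.\<close>
  also have "\<dots> = (C + 1) / (3 * C) * real_of_int (3 * k)"
    using assms(3) by (simp add: field_simps)
  also have "\<dots> \<le> (C + 1) / (3 * C) * real_of_int (Q + 3 * k)"
    using assms(3) \<open>0 \<le> Q\<close> by (intro mult_left_mono) auto
  finally have "real_of_int (P + k - 2) / real_of_int (Q + 3 * k) < (C + 1) / (3 * C)"
    using assms(2) \<open>0 \<le> Q\<close> by (subst pos_divide_less_eq) linarith+
  then show "real_of_int (\<lceil>log 2 (real_of_int (N - k + 1))\<rceil> + k - 2)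
      / real_of_int (\<lceil>log 2 (real_of_int (\<lceil>real_of_int N / real_of_int k\<rceil> - 1))\<rceil> + 3 * k)
      < (C + 1) / (3 * C)"
    by (simp only: P_def Q_def)
  \<comment> \<open>For positive \<open>C\<close> this says \<open>C + 1 < 3 * C\<close>, that is
    \<open>C > 1 / 2\<close>.\<close>
  show "(C + 1) / (3 * C) < 1"
    using assms(3) by (simp add: field_simps)
qed

end
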